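(* If $\pi$ is a $231$-avoiding permutation, then $\operatorname{diam}(G_{\pi})=|L_2(\pi)|$.
   Context: A permutation avoids $231$ if no subsequence of its one-line notation is order isomorphic to $231$. For $\pi\in\mathfrak S_n$, an inversion is a pair $(i,j)$ with $i<j$ and $\pi_i>\pi_j$. $I_2(\pi)$ is the set of unordered pairs of disjoint inversions $\{(i,j),(k,l)\}$ (i.e. $\{i,j\}\cap\{k,l\}=\emptyset$), $I_3(\pi)$ is the set of triples of inversions $((i,j),(i,k),(j,k))$ with $i<j<k$ (equivalently, occurrences of the pattern $321$), and $|L_2(\pi)|:=|I_2(\pi)|+|I_3(\pi)|$. $R(\pi)$ is the set of reduced words of $\pi$ (minimal-length words $r_1\cdots r_\ell$ in $[n-1]$ with $\pi=s_{r_1}\cdots s_{r_\ell}$, $s_i=(i,i+1)$); $G_\pi$ is the graph on $R(\pi)$ whose edges join words related by one commutation move (exchange adjacent $jk$ with $|j-k|>1$) or one long braid move (replace consecutive $j(j+1)j$ by $(j+1)j(j+1)$ or vice versa). Diameter = maximum distance between two vertices. *)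

theory Defs
  imports
    "HOL-Combinatorics.Permutations"
    "HOL-Library.Sublist"
    "Graph_Theory.Pair_Digraph"
    "Graph_Theory.Shortest_Path"
begin

(* Throughout, an element of the symmetric group on [n] is a function p on the naturals with
   p permutes {1..n}. *)

definition one_line :: "nat \<Rightarrow> (nat \<Rightarrow> nat) \<Rightarrow> nat list" where
  "one_line n p = map p [1..<Suc n]"

definition order_isomorphic :: "nat list \<Rightarrow> nat list \<Rightarrow> bool" where
  "order_isomorphic xs ys \<longleftrightarrow> length xs = length ys \<and>
     (\<forall>i < length xs. \<forall>j < length xs. xs ! i < xs ! j \<longleftrightarrow> ys ! i < ys ! j)"

definition avoids :: "nat \<Rightarrow> (nat \<Rightarrow> nat) \<Rightarrow> nat list \<Rightarrow> bool" where
  "avoids n p pat \<longleftrightarrow> \<not> (\<exists>xs. subseq xs (one_line n p) \<and> order_isomorphic xs pat)"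

definition inversions :: "nat \<Rightarrow> (nat \<Rightarrow> nat) \<Rightarrow> (nat \<times> nat) set" where
  "inversions n p = {(i, j). i \<in> {1..n} \<and> j \<in> {1..n} \<and> i < j \<and> p i > p j}"

definition I2 :: "nat \<Rightarrow> (nat \<Rightarrow> nat) \<Rightarrow> (nat \<times> nat) set set" where
  "I2 n p = {{(i, j), (k, l)} | i j k l.
     (i, j) \<in> inversions n p \<and> (k, l) \<in> inversions n p \<and> {i, j} \<inter> {k, l} = {}}"

definition I3 :: "nat \<Rightarrow> (nat \<Rightarrow> nat) \<Rightarrow> ((nat \<times> nat) \<times> (nat \<times> nat) \<times> (nat \<times> nat)) set" where
  "I3 n p = {((i, j), (i, k), (j, k)) | i j k. i < j \<and> j < k \<and>
     (i, j) \<in> inversions n p \<and> (i, k) \<in> inversions n p \<and> (j, k) \<in> inversions n p}"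

definition card_L2 :: "nat \<Rightarrow> (nat \<Rightarrow> nat) \<Rightarrow> nat" where
  "card_L2 n p = card (I2 n p) + card (I3 n p)"

abbreviation adj_transp :: "nat \<Rightarrow> nat \<Rightarrow> nat" where
  "adj_transp i \<equiv> transpose i (Suc i)"

(* Products of permutations are compositions of functions, so the last letter acts first. *)
definition word_perm :: "nat list \<Rightarrow> nat \<Rightarrow> nat" where
  "word_perm w = foldr (\<lambda>r q. adj_transp r \<circ> q) w id"

(* {1..<n} is the alphabet [n-1]; it is empty for n = 0 as well as for n = 1. *)
definition words_for :: "nat \<Rightarrow> (nat \<Rightarrow> nat) \<Rightarrow> nat list set" where
  "words_for n p = {w. set w \<subseteq> {1..<n} \<and> word_perm w = p}"

definition reduced_words :: "nat \<Rightarrow> (nat \<Rightarrow> nat) \<Rightarrow> nat list set" where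
  "reduced_words n p = {w \<in> words_for n p. \<forall>v \<in> words_for n p. length w \<le> length v}"

definition commutation_move :: "nat list \<Rightarrow> nat list \<Rightarrow> bool" where
  "commutation_move u v \<longleftrightarrow> (\<exists>xs ys j k. \<bar>int j - int k\<bar> > 1 \<and>
     u = xs @ [j, k] @ ys \<and> v = xs @ [k, j] @ ys)"

definition braid_move :: "nat list \<Rightarrow> nat list \<Rightarrow> bool" where
  "braid_move u v \<longleftrightarrow> (\<exists>xs ys j.
     (u = xs @ [j, Suc j, j] @ ys \<and> v = xs @ [Suc j, j, Suc j] @ ys) \<or>
     (u = xs @ [Suc j, j, Suc j] @ ys \<and> v = xs @ [j, Suc j, j] @ ys))"

(* The undirected graph is represented by the symmetric digraph with both orientations of
   every edge. *)
definition reduced_word_graph :: "nat \<Rightarrow> (nat \<Rightarrow> nat) \<Rightarrow> nat list pair_pre_digraph" where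
  "reduced_word_graph n p =
     \<lparr> pverts = reduced_words n p,
       parcs = {(u, v). u \<in> reduced_words n p \<and> v \<in> reduced_words n p \<and>
                 (commutation_move u v \<or> braid_move u v)} \<rparr>"

lemma finite_reduced_words: "finite (reduced_words n p)"
proof (cases "reduced_words n p = {}")
  case False
  then obtain w where w: "w \<in> reduced_words n p"
    by blast
  have "reduced_words n p \<subseteq> {v. set v \<subseteq> {1..<n} \<and> length v = length w}"
    using w by (auto simp: reduced_words_def words_for_def intro: antisym)
  then show ?thesis
    using finite_lists_length_eq[of "{1..<n}" "length w"] by (simp add: finite_subset)
qed simp

lemma pair_graph_reduced_word_graph: "pair_graph (reduced_word_graph n p)"
proof -
  have fin: "finite (parcs (reduced_word_graph n p))"
    by (rule finite_subset[of _ "reduced_words n p \<times> reduced_words n p"])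
      (auto simp: reduced_word_graph_def finite_reduced_words)
  have comm: "commutation_move v u" if "commutation_move u v" for u v
    using that unfolding commutation_move_def by (fastforce simp: abs_minus_commute)
  have braid: "braid_move v u" if "braid_move u v" for u v
    using that unfolding braid_move_def by blast
  have "sym (parcs (reduced_word_graph n p))"
    using comm braid by (auto simp: sym_def reduced_word_graph_def)
  moreover have "u \<noteq> v" if "(u, v) \<in> parcs (reduced_word_graph n p)" for u v
    using that unfolding reduced_word_graph_def commutation_move_def braid_move_def by fastforce
  ultimately show ?thesis
    using fin finite_reduced_words[of n p]
    by unfold_locales (auto simp: reduced_word_graph_def symmetric_def)
qed

(* With unit arc costs the shortest path cost is the graph distance; it is infinite when there
   is no walk.  On a finite nonempty vertex set the supremum is the maximum. *)
definition diameter :: "('a, 'b) pre_digraph \<Rightarrow> ereal" where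
  "diameter G = (SUP u \<in> verts G. SUP v \<in> verts G. wf_digraph.\<mu> G (\<lambda>_. 1) u v)"

end

theory Submission
  imports Defs
begin

text \<open>Read from right to left, a reduced word of \<open>\<pi>\<close> creates the inversions of \<open>\<pi>\<close> one at a time,
  hence orders them.  A move changes the relative order of exactly one element of \<open>L\<^sub>2(\<pi>)\<close>, namely
  the two commuting inversions or the outer two \<open>(i, j)\<close>, \<open>(j, k)\<close> of a 321 pattern.  Give a word
  the height \<open>h\<close> counting the elements of \<open>L\<^sub>2(\<pi>)\<close> whose inversion with the smaller first
  entry is created last.  Unless the first entries decrease weakly in the course of time, some move
  increases \<open>h\<close>; unless they increase weakly, some move decreases \<open>h\<close>, and it is only here that
  231-avoidance is used.  There is exactly one word of either sorted kind, a top with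
  \<open>h = |L\<^sub>2(\<pi>)|\<close> and a bottom with \<open>h = 0\<close>.  So the diameter is at least \<open>|L\<^sub>2(\<pi>)|\<close>, and
  travelling through the top or through the bottom gives
  \<open>d(u, v) \<le> min (2|L\<^sub>2(\<pi>)| - h(u) - h(v)) (h(u) + h(v)) \<le> |L\<^sub>2(\<pi>)|\<close>.\<close>

section \<open>Diameters from a height function\<close>

text \<open>\<open>A\<close> and \<open>B\<close> mark the unique peak and the unique bottom of
  \<open>f\<close>. Their existence comes out of the proof: climbing or descending from any vertex
  must end, since \<open>f\<close> lies between 0 and \<open>N\<close>.\<close>

lemma diameter_eqI:
  fixes f :: "'a \<Rightarrow> nat"
  assumes G: "pair_graph G" and ne: "pverts G \<noteq> {}"
    and step: "\<And>u v. (u, v) \<in> parcs G \<Longrightarrow> f u \<le> Suc (f v)"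
    and up: "\<And>u. u \<in> pverts G \<Longrightarrow> \<not> A u \<Longrightarrow> \<exists>v. (u, v) \<in> parcs G \<and> f u < f v"
    and down: "\<And>u. u \<in> pverts G \<Longrightarrow> \<not> B u \<Longrightarrow> \<exists>v. (u, v) \<in> parcs G \<and> f v < f u"
    and le: "\<And>u. u \<in> pverts G \<Longrightarrow> f u \<le> N"
    and top: "\<And>u. u \<in> pverts G \<Longrightarrow> A u \<Longrightarrow> f u = N"
    and bot: "\<And>u. u \<in> pverts G \<Longrightarrow> B u \<Longrightarrow> f u = 0"
    and A: "\<And>u v. u \<in> pverts G \<Longrightarrow> v \<in> pverts G \<Longrightarrow> A u \<Longrightarrow> A v \<Longrightarrow> u = v"
    and B: "\<And>u v. u \<in> pverts G \<Longrightarrow> v \<in> pverts G \<Longrightarrow> B u \<Longrightarrow> B v \<Longrightarrow> u = v"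
  shows "diameter (with_proj G) = ereal (real N)"
proof -
  interpret pair_graph G by (rule G)
  have length_rev_path: "length (rev_path p) = length p" for p :: "('a \<times> 'a) list"
    by (induction p) auto
  have cost: "awalk_cost (\<lambda>_. 1) p = real (length p)" for p :: "('a \<times> 'a) list"
    by (induction p) auto
  have lower: "f u \<le> f v + length p" if "awalk u p v" for u p v
    using that
  proof (induction p arbitrary: u)
    case (Cons e p)
    then have "e \<in> parcs G" "fst e = u" "awalk (snd e) p v"
      by (auto simp: awalk_Cons_iff)
    with Cons.IH[of "snd e"] step[of "u" "snd e"] show ?case
      by (cases e) auto
  qed (simp add: awalk_Nil_iff)
  have to_top: "\<exists>t p. t \<in> pverts G \<and> A t \<and> awalk u p t \<and> length p \<le> N - f u"
    if "u \<in> pverts G" for u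
    using that
  proof (induction "N - f u" arbitrary: u rule: less_induct)
    case less
    show ?case
    proof (cases "A u")
      case True
      with less.prems show ?thesis
        by (intro exI[of _ u] exI[of _ "[]"]) (simp add: awalk_Nil_iff)
    next
      case False
      with up less.prems obtain v where v: "(u, v) \<in> parcs G" "f u < f v" by blast
      then have "v \<in> pverts G" by (auto dest: in_arcsD2)
      moreover from this v le[of v] have "N - f v < N - f u" by simp
      ultimately obtain t p where
        "t \<in> pverts G" "A t" "awalk v p t" "length p \<le> N - f v"
        using less.hyps by blast
      with v \<open>N - f v < N - f u\<close> less.prems show ?thesis
        by (intro exI[of _ t] exI[of _ "(u, v) # p"]) (auto simp: awalk_Cons_iff)
    qed
  qed
  have to_bot: "\<exists>t p. t \<in> pverts G \<and> B t \<and> awalk u p t \<and> length p \<le> f u"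
    if "u \<in> pverts G" for u
    using that
  proof (induction "f u" arbitrary: u rule: less_induct)
    case less
    show ?case
    proof (cases "B u")
      case True
      with less.prems show ?thesis
        by (intro exI[of _ u] exI[of _ "[]"]) (simp add: awalk_Nil_iff)
    next
      case False
      with down less.prems obtain v where v: "(u, v) \<in> parcs G" "f v < f u" by blast
      then have "v \<in> pverts G" by (auto dest: in_arcsD2)
      with v obtain t p where
        "t \<in> pverts G" "B t" "awalk v p t" "length p \<le> f v"
        using less.hyps by blast
      with v less.prems show ?thesis
        by (intro exI[of _ t] exI[of _ "(u, v) # p"]) (auto simp: awalk_Cons_iff)
    qed
  qed
  have via: "\<mu> (\<lambda>_. 1) u v \<le> ereal (real (length p + length q))"
    if "awalk u p t" "awalk v q t" for u v t p q
  proof -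
    \<comment> \<open>The graph is symmetric, so the walk from \<open>v\<close> to \<open>t\<close>
      can be traversed backwards.\<close>
    have "awalk u (p @ rev_path q) v"
      using that by (auto intro: awalk_rev_path)
    from min_cost_le_walk_cost[OF this, of "\<lambda>_. 1"] show ?thesis
      by (simp only: cost length_append length_rev_path)
  qed
  \<comment> \<open>The detour through the peak has length at most
    \<open>(N - f u) + (N - f v)\<close>, the one through the bottom at most
    \<open>f u + f v\<close>. The case split picks one that does not exceed
    \<open>N\<close>.\<close>
  have upper: "\<mu> (\<lambda>_. 1) u v \<le> ereal (real N)" if uv: "u \<in> pverts G" "v \<in> pverts G" for u v
  proof (cases "N \<le> f u + f v")
    case True
    obtain t p t' q where "awalk u p t" "length p \<le> N - f u" "awalk v q t'" "length q \<le> N - f v"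
      and "t = t'"
      using to_top[OF uv(1)] to_top[OF uv(2)] A by metis
    with via[of u p t v q] le[OF uv(1)] le[OF uv(2)] True show ?thesis
      by (intro order_trans[OF via]) auto
  next
    case False
    obtain t p t' q where "awalk u p t" "length p \<le> f u" "awalk v q t'" "length q \<le> f v"
      and "t = t'"
      using to_bot[OF uv(1)] to_bot[OF uv(2)] B by metis
    with False show ?thesis
      by (intro order_trans[OF via]) auto
  qed
  obtain s t where s: "s \<in> pverts G" "A s" and t: "t \<in> pverts G" "B t"
    using ne to_top to_bot by blast
  \<comment> \<open>Along an arc \<open>f\<close> drops by at most one, and from \<open>s\<close> to
    \<open>t\<close> it drops from \<open>N\<close> to 0.\<close>
  have "ereal (real N) \<le> \<mu> (\<lambda>_. 1) s t"
    unfolding \<mu>_def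
  proof (intro INF_greatest)
    fix p assume "p \<in> {p. awalk s p t}"
    with lower[of s p t] top[OF s] bot[OF t] show "ereal (real N) \<le> ereal (awalk_cost (\<lambda>_. 1) p)"
      by (simp only: cost) simp
  qed
  with s t show ?thesis
    unfolding diameter_def
    by (intro antisym SUP_least) (auto intro: upper SUP_upper2)
qed

section \<open>Words and inversions\<close>

text \<open>Inversions are pairs of positions, so a letter \<open>r\<close> put in front of \<open>w\<close> swaps the values \<open>r\<close>
  and \<open>r + 1\<close>; \<open>word_perm (rev w)\<close>, the inverse of \<open>word_perm w\<close>, gives their positions.  The
  inversion created last comes first in \<open>inversion_seq\<close>.\<close>

definition inv_pairs :: "(nat \<Rightarrow> nat) \<Rightarrow> (nat \<times> nat) set" where
  "inv_pairs q = {(i, j). i < j \<and> q j < q i}"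

fun inversion_seq :: "nat list \<Rightarrow> (nat \<times> nat) list" where
  "inversion_seq [] = []"
| "inversion_seq (r # w) =
     (word_perm (rev w) r, word_perm (rev w) (Suc r)) # inversion_seq w"

text \<open>No letter destroys an inversion. By \<open>reduced_words_eq\<close> this is a
  letter-by-letter form of reducedness.\<close>

definition ascending_word :: "nat list \<Rightarrow> bool" where
  "ascending_word w \<longleftrightarrow> (\<forall>(a, b) \<in> set (inversion_seq w). a < b)"

lemma word_perm_Nil [simp]: "word_perm [] = id"
  by (simp add: word_perm_def)

lemma word_perm_Cons: "word_perm (r # w) = adj_transp r \<circ> word_perm w"
  by (simp add: word_perm_def)

lemma word_perm_append: "word_perm (u @ v) = word_perm u \<circ> word_perm v"
  by (induction u) (simp_all add: word_perm_Cons comp_assoc)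

lemma word_perm_Cons_apply: "word_perm (r # w) x = adj_transp r (word_perm w x)"
  by (simp add: word_perm_Cons)

lemma word_perm_append_apply: "word_perm (u @ v) x = word_perm u (word_perm v x)"
  by (simp add: word_perm_append)

lemmas word_perm_apply = word_perm_Cons_apply word_perm_append_apply

lemma word_perm_rev_left [simp]: "word_perm (rev w) (word_perm w x) = x"
  by (induction w arbitrary: x) (auto simp: word_perm_apply)

lemma word_perm_rev_right [simp]: "word_perm w (word_perm (rev w) x) = x"
  using word_perm_rev_left[of "rev w"] by simp

lemma bij_word_perm: "bij (word_perm w)"
  by (rule bij_betw_byWitness[where f' = "word_perm (rev w)"]) auto

lemma word_perm_eq_iff [simp]: "word_perm w x = word_perm w y \<longleftrightarrow> x = y"
  using bij_word_perm[of w] by (auto simp: bij_def inj_eq)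

lemma length_inversion_seq [simp]: "length (inversion_seq w) = length w"
  by (induction w) auto

lemma inversion_seq_append:
  "inversion_seq (u @ v) =
     map (map_prod (word_perm (rev v)) (word_perm (rev v))) (inversion_seq u) @ inversion_seq v"
  by (induction u) (auto simp: word_perm_append_apply)

text \<open>Once the tails agree, one and the same injective map sends the first letter to the first
  entry of the head.\<close>

lemma inversion_seq_inject:
  "inversion_seq v = inversion_seq w \<Longrightarrow> v = w"
proof (induction v arbitrary: w)
  case (Cons r v)
  then show ?case by (cases w) auto
qed (metis length_0_conv length_inversion_seq)

text \<open>Turns a cut of the sequence into a cut of the word. The pairs of \<open>u\<close> are
  relabelled because the letters of \<open>v\<close> act before those of \<open>u\<close>.\<close>

lemma inversion_seq_eq_append:
  assumes "inversion_seq w = xs @ ys"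
  obtains u v where "w = u @ v" "inversion_seq v = ys"
    "map (map_prod (word_perm (rev v)) (word_perm (rev v))) (inversion_seq u) = xs"
proof
  let ?u = "take (length xs) w" and ?v = "drop (length xs) w"
  have "length w = length xs + length ys"
    using assms length_inversion_seq[of w] by simp
  then show "inversion_seq ?v = ys"
    "map (map_prod (word_perm (rev ?v)) (word_perm (rev ?v))) (inversion_seq ?u) = xs"
    using assms inversion_seq_append[of ?u ?v] by auto
qed simp

text \<open>Outside \<open>{1..n}\<close> the permutation is the identity, so no inversion reaches
  beyond \<open>{1..n}\<close> and \<open>inv_pairs\<close> can do without the bound.\<close>

lemma inv_pairs_permutes:
  assumes "p permutes {1..n}"
  shows "inv_pairs p = inversions n p"
proof -
  have bounds: "p x \<le> n" "1 \<le> x" if "1 \<le> p x" "x \<le> n" for x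
    using that permutes_in_image[OF assms, of x] permutes_not_in[OF assms, of x]
    by (cases "x = 0"; auto)+
  have fix_gt: "p x = x" if "n < x" for x
    using that by (intro permutes_not_in[OF assms]) auto
  have "i \<in> {1..n} \<and> j \<in> {1..n}" if "i < j" "p j < p i" for i j
    using that bounds[of i] fix_gt[of i] fix_gt[of j]
    by (cases "n < i"; cases "n < j") auto
  then show ?thesis
    by (auto simp: inv_pairs_def inversions_def)
qed

lemma finite_inversions: "finite (inversions n p)"
  by (rule finite_subset[of _ "{1..n} \<times> {1..n}"]) (auto simp: inversions_def)

text \<open>No value lies strictly between \<open>r\<close> and \<open>Suc r\<close>, so swapping
  them affects no other comparison.\<close>

lemma adj_transp_less_iff:
  assumes "x \<noteq> y" "{x, y} \<noteq> {r, Suc r}"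
  shows "adj_transp r x < adj_transp r y \<longleftrightarrow> x < y"
  using assms by (auto simp: transpose_def doubleton_eq_iff)

lemma inv_pairs_adj_transp_up:
  assumes "inj q" "q a = r" "q b = Suc r" "a < b"
  shows "inv_pairs (adj_transp r \<circ> q) = insert (a, b) (inv_pairs q)"
    and "(a, b) \<notin> inv_pairs q"
proof -
  have "(i, j) \<in> inv_pairs (adj_transp r \<circ> q) \<longleftrightarrow> (i, j) \<in> insert (a, b) (inv_pairs q)"
    if "i < j" for i j
  proof (cases "{q i, q j} = {r, Suc r}")
    case True
    then have "(i = a \<and> j = b) \<or> (i = b \<and> j = a)"
      using assms by (metis doubleton_eq_iff injD)
    then show ?thesis
      using assms that by (auto simp: inv_pairs_def)
  next
    case False
    then show ?thesis
      using assms that adj_transp_less_iff[of "q j" "q i" r]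
      by (auto simp: inv_pairs_def inj_eq insert_commute)
  qed
  then show "inv_pairs (adj_transp r \<circ> q) = insert (a, b) (inv_pairs q)"
    using assms(4) by (auto simp: inv_pairs_def)
  show "(a, b) \<notin> inv_pairs q"
    using assms by (auto simp: inv_pairs_def)
qed

text \<open>The transposition is an involution, so this is \<open>inv_pairs_adj_transp_up\<close>
  read backwards.\<close>

lemma inv_pairs_adj_transp_down:
  assumes "inj q" "q a = r" "q b = Suc r" "b < a"
  shows "inv_pairs q = insert (b, a) (inv_pairs (adj_transp r \<circ> q))"
    and "(b, a) \<notin> inv_pairs (adj_transp r \<circ> q)"
proof -
  let ?q = "adj_transp r \<circ> q"
  have *: "inj ?q" "?q b = r" "?q a = Suc r"
    using assms by (auto intro!: inj_compose)
  show "inv_pairs q = insert (b, a) (inv_pairs ?q)"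
    using inv_pairs_adj_transp_up(1)[OF * assms(4)] by (simp add: comp_def)
  show "(b, a) \<notin> inv_pairs ?q"
    by (rule inv_pairs_adj_transp_up(2)[OF * assms(4)])
qed

lemma inv_pairs_word_perm_Cons:
  fixes r w
  defines "a \<equiv> word_perm (rev w) r" and "b \<equiv> word_perm (rev w) (Suc r)"
  shows "a < b \<Longrightarrow> inv_pairs (word_perm (r # w)) = insert (a, b) (inv_pairs (word_perm w))"
    and "a < b \<Longrightarrow> (a, b) \<notin> inv_pairs (word_perm w)"
    and "\<not> a < b \<Longrightarrow> inv_pairs (word_perm (r # w)) \<subset> inv_pairs (word_perm w)"
proof -
  have *: "inj (word_perm w)" "word_perm w a = r" "word_perm w b = Suc r"
    using bij_word_perm by (auto simp: a_def b_def bij_def)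
  show "a < b \<Longrightarrow> inv_pairs (word_perm (r # w)) = insert (a, b) (inv_pairs (word_perm w))"
    "a < b \<Longrightarrow> (a, b) \<notin> inv_pairs (word_perm w)"
    unfolding word_perm_Cons using inv_pairs_adj_transp_up[OF *] by blast+
  assume "\<not> a < b"
  moreover have "a \<noteq> b"
    using * by auto
  ultimately show "inv_pairs (word_perm (r # w)) \<subset> inv_pairs (word_perm w)"
    unfolding word_perm_Cons using inv_pairs_adj_transp_down[OF *] by auto
qed

section \<open>Words in which every letter creates an inversion\<close>

lemma ascending_word_append: "ascending_word (u @ v) \<Longrightarrow> ascending_word v"
  by (auto simp: ascending_word_def inversion_seq_append)

lemma inversion_seq_ascending:
  assumes "ascending_word w"
  shows "distinct (inversion_seq w)" "set (inversion_seq w) = inv_pairs (word_perm w)"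
proof -
  have "distinct (inversion_seq w) \<and> set (inversion_seq w) = inv_pairs (word_perm w)"
    using assms
  proof (induction w)
    case Nil
    then show ?case by (auto simp: inv_pairs_def)
  next
    case (Cons r w)
    then have "ascending_word w" "word_perm (rev w) r < word_perm (rev w) (Suc r)"
      by (auto simp: ascending_word_def)
    with Cons.IH show ?case
      using inv_pairs_word_perm_Cons(1,2)[of w r] by auto
  qed
  then show "distinct (inversion_seq w)" "set (inversion_seq w) = inv_pairs (word_perm w)"
    by auto
qed

lemma finite_inv_pairs_word_perm: "finite (inv_pairs (word_perm w))"
proof (induction w)
  case (Cons r w)
  then show ?case
    using inv_pairs_word_perm_Cons(1,3)[of w r]
    by (metis finite_insert finite_subset psubset_imp_subset)
qed (auto simp: inv_pairs_def intro: finite_subset[of _ "{}"])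

lemma card_inv_pairs_le_length: "card (inv_pairs (word_perm w)) \<le> length w"
proof (induction w)
  case (Cons r w)
  show ?case
  proof (cases "word_perm (rev w) r < word_perm (rev w) (Suc r)")
    case True
    then show ?thesis
      using Cons inv_pairs_word_perm_Cons(1)[of w r] finite_inv_pairs_word_perm[of w]
      by (simp add: card_insert_if)
  next
    case False
    then show ?thesis
      using Cons psubset_card_mono[OF finite_inv_pairs_word_perm inv_pairs_word_perm_Cons(3)[of w r]]
      by simp
  qed
qed (auto simp: inv_pairs_def card_eq_0_iff)

text \<open>Each letter adds at most one inversion, so a count equal to the length leaves no room
  for a letter that destroys one.\<close>

lemma ascending_word_if_card:
  "card (inv_pairs (word_perm w)) = length w \<Longrightarrow> ascending_word w"
proof (induction w)
  case (Cons r w)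
  have *: "word_perm (rev w) r < word_perm (rev w) (Suc r)"
  proof (rule ccontr)
    assume "\<not> ?thesis"
    then have "card (inv_pairs (word_perm (r # w))) < card (inv_pairs (word_perm w))"
      by (intro psubset_card_mono finite_inv_pairs_word_perm inv_pairs_word_perm_Cons(3))
    with card_inv_pairs_le_length[of w] Cons.prems show False by simp
  qed
  then have "card (inv_pairs (word_perm w)) = length w"
    using Cons.prems inv_pairs_word_perm_Cons(1,2)[of w r] finite_inv_pairs_word_perm[of w]
    by simp
  with Cons.IH * show ?case by (simp add: ascending_word_def)
qed (simp add: ascending_word_def)

text \<open>Sorting by swaps of consecutive values: as long as some value \<open>Suc r\<close>
  stands to the left of \<open>r\<close>, swapping the two removes exactly one inversion. The
  inverse of \<open>p\<close> gives the positions of the values.\<close>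

lemma ex_word_card_inversions:
  assumes "p permutes {1..n}"
  shows "\<exists>w. set w \<subseteq> {1..<n} \<and> word_perm w = p \<and> length w = card (inversions n p)"
  using assms
proof (induction "card (inversions n p)" arbitrary: p rule: less_induct)
  case less
  let ?q = "inv p"
  have q: "?q permutes {1..n}" and bij: "bij p"
    using less.prems by (auto intro: permutes_inv permutes_bij)
  have pq: "p (?q x) = x" "?q (p x) = x" for x
    using less.prems by (auto simp: permutes_inverses)
  show ?case
  proof (cases "\<exists>r \<in> {1..<n}. ?q (Suc r) < ?q r")
    case True
    then obtain r where r: "r \<in> {1..<n}" "?q (Suc r) < ?q r" by blast
    let ?p = "adj_transp r \<circ> p"
    have "adj_transp r permutes {1..n}"
      using r by (intro permutes_swap_id) auto
    with less.prems have p': "?p permutes {1..n}"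
      by (rule permutes_compose)
    have "inversions n p = insert (?q (Suc r), ?q r) (inversions n ?p)"
      "(?q (Suc r), ?q r) \<notin> inversions n ?p"
      using inv_pairs_adj_transp_down[of p "?q r" r "?q (Suc r)"] r bij p' less.prems
      by (auto simp: pq bij_def inv_pairs_permutes[symmetric])
    then have c: "card (inversions n p) = Suc (card (inversions n ?p))"
      by (simp add: finite_inversions)
    with less.hyps[of ?p] p' obtain w where
      w: "set w \<subseteq> {1..<n}" "word_perm w = ?p" "length w = card (inversions n ?p)"
      by auto
    have "word_perm (r # w) = p"
      using w by (simp add: word_perm_Cons comp_assoc[symmetric])
    with w c r show ?thesis
      by (intro exI[of _ "r # w"]) auto
  next
    case False
    have range: "1 \<le> ?q x \<and> ?q x \<le> n" if "1 \<le> x" "x \<le> n" for x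
      using that permutes_in_image[OF q, of x] by simp
    have fixed: "?q x = x" if "x = 0 \<or> n < x" for x
      using that by (intro permutes_not_in[OF q]) auto
    \<comment> \<open>For \<open>r\<close> outside \<open>{1..<n}\<close> this holds because
      \<open>?q\<close> maps \<open>{1..n}\<close> to itself and fixes everything else.\<close>
    have "?q r < ?q (Suc r)" for r
    proof (cases "r \<in> {1..<n}")
      case True
      with False have "?q r \<le> ?q (Suc r)" by (auto simp: not_less)
      moreover have "?q r \<noteq> ?q (Suc r)"
        by (metis pq(1) n_not_Suc_n)
      ultimately show ?thesis by simp
    next
      case outside: False
      then show ?thesis
        using range[of r] range[of "Suc r"] fixed[of r] fixed[of "Suc r"]
        by (cases "r = 0"; cases "n < r"; cases "n = 0") auto
    qed
    then have q_mono: "strict_mono ?q"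
      by (simp add: strict_mono_Suc_iff)
    have p_mono: "strict_mono p"
    proof (rule strict_monoI)
      fix x y :: nat assume "x < y"
      then show "p x < p y"
        using strict_mono_less[OF q_mono, of "p x" "p y"] by (simp add: pq)
    qed
    \<comment> \<open>A strictly increasing map on the naturals never falls below the identity; for
      \<open>p\<close> and its inverse together this forces equality.\<close>
    have "p x = x" for x
    proof (rule antisym)
      have "x \<le> ?q x" by (rule strict_mono_imp_increasing[OF q_mono])
      then show "p x \<le> x"
        using strict_mono_less_eq[OF p_mono, of x "?q x"] by (simp add: pq)
      show "x \<le> p x" by (rule strict_mono_imp_increasing[OF p_mono])
    qed
    then have "p = id" by auto
    moreover have "inversions n p = {}"
      using \<open>\<And>x. p x = x\<close> by (auto simp: inversions_def)
    ultimately show ?thesis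
      by (intro exI[of _ "[]"]) auto
  qed
qed

text \<open>The minimal length is the number of inversions: \<open>card_inv_pairs_le_length\<close>
  bounds it from below and \<open>ex_word_card_inversions\<close> attains the bound.\<close>

lemma reduced_words_eq:
  assumes "p permutes {1..n}"
  shows "reduced_words n p = {w \<in> words_for n p. ascending_word w}"
proof -
  obtain v where v: "v \<in> words_for n p" "length v = card (inversions n p)"
    using ex_word_card_inversions[OF assms] by (auto simp: words_for_def)
  have ge: "card (inversions n p) \<le> length w" if "w \<in> words_for n p" for w
    using that card_inv_pairs_le_length[of w] inv_pairs_permutes[OF assms]
    by (auto simp: words_for_def)
  have "length w = card (inversions n p) \<longleftrightarrow> ascending_word w" if "w \<in> words_for n p" for w
  proof
    assume "length w = card (inversions n p)"
    with that show "ascending_word w"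
      by (intro ascending_word_if_card) (auto simp: words_for_def inv_pairs_permutes[OF assms])
  next
    assume "ascending_word w"
    then show "length w = card (inversions n p)"
      using that distinct_card[of "inversion_seq w"] inversion_seq_ascending[of w]
      by (simp add: words_for_def inv_pairs_permutes[OF assms])
  qed
  then show ?thesis
    using v ge unfolding reduced_words_def by (intro Collect_cong) (metis mem_Collect_eq le_antisym)
qed

lemma reduced_words_nonempty:
  assumes "p permutes {1..n}"
  shows "reduced_words n p \<noteq> {}"
proof -
  obtain v where "v \<in> words_for n p" "length v = card (inversions n p)"
    using ex_word_card_inversions[OF assms] by (auto simp: words_for_def)
  then have "v \<in> reduced_words n p"
    using assms by (auto simp: reduced_words_eq words_for_def inv_pairs_permutes
        intro: ascending_word_if_card)
  then show ?thesis by blast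
qed

section \<open>The order of creation of inversions\<close>

text \<open>The latest inversion heads an inversion sequence, so there \<open>(a, b)\<close> means
  that \<open>a\<close> is created after \<open>b\<close>.\<close>

fun list_order :: "'a list \<Rightarrow> ('a \<times> 'a) set" where
  "list_order [] = {}"
| "list_order (x # xs) = {x} \<times> set xs \<union> list_order xs"

lemma list_order_append:
  "list_order (xs @ ys) = list_order xs \<union> set xs \<times> set ys \<union> list_order ys"
  by (induction xs) auto

lemma list_order_subset: "list_order xs \<subseteq> set xs \<times> set xs"
  by (induction xs) auto

lemma list_orderD: "(a, b) \<in> list_order xs \<Longrightarrow> a \<in> set xs \<and> b \<in> set xs"
  using list_order_subset by fastforce

lemma list_order_total:
  "a \<in> set xs \<Longrightarrow> b \<in> set xs \<Longrightarrow> a \<noteq> b \<Longrightarrow> (a, b) \<in> list_order xs \<or> (b, a) \<in> list_order xs"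
  by (induction xs) auto

lemma list_order_asym:
  "distinct xs \<Longrightarrow> (a, b) \<in> list_order xs \<Longrightarrow> (b, a) \<notin> list_order xs"
  by (induction xs) (auto dest: list_orderD)

lemma sorted_wrt_iff_list_order: "sorted_wrt R xs \<longleftrightarrow> (\<forall>(a, b) \<in> list_order xs. R a b)"
  by (induction xs) auto

text \<open>If the heads differed, each would occur behind the other, and \<open>R\<close> would
  hold both ways.\<close>

lemma sorted_wrt_unique:
  assumes "\<And>a b. R a b \<Longrightarrow> \<not> R b a"
    and "sorted_wrt R xs" "sorted_wrt R ys" "set xs = set ys" "distinct xs" "distinct ys"
  shows "xs = ys"
  using assms(2-)
proof (induction xs arbitrary: ys)
  case (Cons x xs)
  then obtain y ys' where ys: "ys = y # ys'" by (cases ys) auto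
  have "x = y"
  proof (rule ccontr)
    assume "x \<noteq> y"
    with Cons.prems ys have "x \<in> set ys'" "y \<in> set xs" by auto
    with Cons.prems ys have "R x y" "R y x" by auto
    with assms(1) show False by blast
  qed
  moreover have "set xs = set ys'"
    using Cons.prems ys \<open>x = y\<close> by auto
  ultimately show ?case
    using Cons ys by auto
qed simp

text \<open>The entries behind \<open>a\<close> form such a suffix. In an inversion sequence it is a
  moment at which \<open>b\<close> is present and \<open>a\<close> is not.\<close>

lemma list_order_suffixE:
  assumes "distinct xs" "(a, b) \<in> list_order xs"
  obtains ys where "suffix ys xs" "b \<in> set ys" "a \<notin> set ys"
proof -
  have "\<exists>ys. suffix ys xs \<and> b \<in> set ys \<and> a \<notin> set ys"
    using assms
  proof (induction xs)
    case (Cons x xs)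
    show ?case
    proof (cases "a = x")
      case True
      with Cons.prems show ?thesis
        by (intro exI[of _ xs]) (auto simp: suffix_Cons dest: list_orderD)
    next
      case False
      with Cons show ?thesis by (auto simp: suffix_Cons)
    qed
  qed simp
  with that show ?thesis by blast
qed

lemma list_order_suffix_closed:
  assumes "distinct xs" "suffix ys xs" "(a, b) \<in> list_order xs" "a \<in> set ys"
  shows "b \<in> set ys"
proof -
  obtain us where "xs = us @ ys"
    using assms(2) by (auto simp: suffix_def)
  with assms show ?thesis
    by (auto simp: list_order_append dest: list_orderD)
qed

section \<open>Transitivity and cotransitivity of inversion sets, applied at every moment\<close>

lemma inv_pairs_trans:
  "(i, j) \<in> inv_pairs q \<Longrightarrow> (j, k) \<in> inv_pairs q \<Longrightarrow> (i, k) \<in> inv_pairs q"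
  by (auto simp: inv_pairs_def)

lemma inv_pairs_cotrans:
  "(i, k) \<in> inv_pairs q \<Longrightarrow> i < j \<Longrightarrow> j < k \<Longrightarrow> (i, j) \<in> inv_pairs q \<or> (j, k) \<in> inv_pairs q"
  by (auto simp: inv_pairs_def)

text \<open>A suffix of the sequence belongs to a suffix of the word, whose product is an
  intermediate permutation.\<close>

lemma inversion_seq_suffix:
  assumes "ascending_word w" "suffix ys (inversion_seq w)"
  obtains q where "set ys = inv_pairs q"
proof -
  obtain xs where "inversion_seq w = xs @ ys"
    using assms(2) by (auto simp: suffix_def)
  then obtain u v where uv: "w = u @ v" "inversion_seq v = ys"
    by (rule inversion_seq_eq_append)
  then have "ascending_word v"
    using assms(1) ascending_word_append by blast
  with uv that show ?thesis
    using inversion_seq_ascending(2) by blast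
qed

context
  fixes w :: "nat list" and i j k :: nat
  assumes w: "ascending_word w" and ijk: "i < j" "j < k"
begin

text \<open>Otherwise there is a moment with \<open>(i, j)\<close> present and \<open>(i, k)\<close>
  absent. Then \<open>(j, k)\<close>, being older than \<open>(i, j)\<close>, is present too,
  against transitivity.\<close>

lemma inversion_seq_inner_first:
  assumes "((i, j), (j, k)) \<in> list_order (inversion_seq w)"
  shows "((i, j), (i, k)) \<in> list_order (inversion_seq w)"
proof -
  note d = inversion_seq_ascending(1)[OF w] and s = inversion_seq_ascending(2)[OF w]
  have mem: "(i, j) \<in> set (inversion_seq w)" "(j, k) \<in> set (inversion_seq w)"
    using assms list_orderD by fastforce+
  then have ik: "(i, k) \<in> set (inversion_seq w)"
    using inv_pairs_trans by (auto simp: s)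
  show "((i, j), (i, k)) \<in> list_order (inversion_seq w)"
  proof (rule ccontr)
    assume "\<not> ?thesis"
    then have "((i, k), (i, j)) \<in> list_order (inversion_seq w)"
      using list_order_total[OF ik mem(1)] ijk by auto
    then obtain ys where ys: "suffix ys (inversion_seq w)" "(i, j) \<in> set ys" "(i, k) \<notin> set ys"
      using list_order_suffixE[OF d] by metis
    then have "(j, k) \<in> set ys"
      using list_order_suffix_closed[OF d] assms by blast
    with ys inversion_seq_suffix[OF w ys(1)] inv_pairs_trans show False by metis
  qed
qed

text \<open>Otherwise there is a moment with \<open>(i, k)\<close> present and \<open>(i, j)\<close>
  absent. Then \<open>(j, k)\<close>, being younger than \<open>(i, j)\<close>, is absent too,
  against cotransitivity.\<close>

lemma inversion_seq_inner_last:
  assumes "((j, k), (i, j)) \<in> list_order (inversion_seq w)"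
  shows "((i, k), (i, j)) \<in> list_order (inversion_seq w)"
proof -
  note d = inversion_seq_ascending(1)[OF w] and s = inversion_seq_ascending(2)[OF w]
  have mem: "(i, j) \<in> set (inversion_seq w)" "(j, k) \<in> set (inversion_seq w)"
    using assms list_orderD by fastforce+
  then have ik: "(i, k) \<in> set (inversion_seq w)"
    using inv_pairs_trans by (auto simp: s)
  show "((i, k), (i, j)) \<in> list_order (inversion_seq w)"
  proof (rule ccontr)
    assume "\<not> ?thesis"
    then have "((i, j), (i, k)) \<in> list_order (inversion_seq w)"
      using list_order_total[OF ik mem(1)] ijk by auto
    then obtain ys where ys: "suffix ys (inversion_seq w)" "(i, k) \<in> set ys" "(i, j) \<notin> set ys"
      using list_order_suffixE[OF d] by metis
    then have "(j, k) \<notin> set ys"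
      using list_order_suffix_closed[OF d] assms by blast
    with ys inversion_seq_suffix[OF w ys(1)] inv_pairs_cotrans ijk show False by metis
  qed
qed

text \<open>As \<open>(j, k)\<close> never appears, cotransitivity forbids \<open>(i, k)\<close> to
  be present without \<open>(i, j)\<close>.\<close>

lemma inversion_seq_312:
  assumes "(i, j) \<in> inv_pairs (word_perm w)" "(i, k) \<in> inv_pairs (word_perm w)"
    and "(j, k) \<notin> inv_pairs (word_perm w)"
  shows "((i, k), (i, j)) \<in> list_order (inversion_seq w)"
proof (rule ccontr)
  note d = inversion_seq_ascending(1)[OF w] and s = inversion_seq_ascending(2)[OF w]
  assume "\<not> ?thesis"
  then have "((i, j), (i, k)) \<in> list_order (inversion_seq w)"
    using list_order_total[of "(i, j)" "inversion_seq w" "(i, k)"] ijk assms by (auto simp: s)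
  then obtain ys where ys: "suffix ys (inversion_seq w)" "(i, k) \<in> set ys" "(i, j) \<notin> set ys"
    using list_order_suffixE[OF d] by metis
  then have "(j, k) \<notin> set ys"
    using assms s set_mono_suffix by blast
  with ys inversion_seq_suffix[OF w ys(1)] inv_pairs_cotrans ijk show False by metis
qed

end

section \<open>Words whose inversions are sorted by first entry\<close>

text \<open>Ascending along the list means descending in time: these are the top words, and
  \<open>fst_descending\<close> describes the bottom words.\<close>

definition fst_ascending :: "nat list \<Rightarrow> bool" where
  "fst_ascending w \<longleftrightarrow> sorted_wrt (\<lambda>a b. fst a \<le> fst b) (inversion_seq w)"

definition fst_descending :: "nat list \<Rightarrow> bool" where
  "fst_descending w \<longleftrightarrow> sorted_wrt (\<lambda>a b. fst b \<le> fst a) (inversion_seq w)"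

text \<open>Inversions between positions after \<open>i\<close> are created before those with first
  entry \<open>i\<close>, so \<open>i\<close> passes the smaller values in their final order. The
  relation obtained is asymmetric and depends on \<open>w\<close> only through
  \<open>word_perm w\<close>, which gives uniqueness.\<close>

lemma fst_ascending_sorted_wrt:
  assumes w: "ascending_word w" and asc: "fst_ascending w"
  shows "sorted_wrt (\<lambda>(i, j) (i', j'). i < i' \<or> i = i' \<and> word_perm w j' < word_perm w j)
    (inversion_seq w)"
proof -
  note d = inversion_seq_ascending(1)[OF w] and s = inversion_seq_ascending(2)[OF w]
  have "i < i' \<or> i = i' \<and> word_perm w j' < word_perm w j"
    if ab: "((i, j), (i', j')) \<in> list_order (inversion_seq w)" for i j i' j'
  proof -
    have "i \<le> i'"
      using asc ab unfolding fst_ascending_def sorted_wrt_iff_list_order by auto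
    moreover have False if "i = i'" "\<not> word_perm w j' < word_perm w j"
    proof -
      have inv: "(i, j) \<in> inv_pairs (word_perm w)" "(i, j') \<in> inv_pairs (word_perm w)"
        and ne: "j \<noteq> j'"
        using list_orderD[OF ab] list_order_asym[OF d ab] that(1) ab by (auto simp: s)
      have "word_perm w j \<noteq> word_perm w j'" using ne by simp
      with that have lt: "word_perm w j < word_perm w j'" by linarith
      have less: "i < j" "i < j'" using inv by (auto simp: inv_pairs_def)
      show False
      proof (cases "j < j'")
        case True
        with lt have "(j, j') \<notin> inv_pairs (word_perm w)" by (auto simp: inv_pairs_def)
        with inversion_seq_312[OF w less(1) True] inv list_order_asym[OF d ab] that
        show False by simp
      next
        case False
        with ne have "j' < j" by simp
        with lt have jj: "(j', j) \<in> inv_pairs (word_perm w)" by (auto simp: inv_pairs_def)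
        have "((j', j), (i, j')) \<notin> list_order (inversion_seq w)"
          using asc less unfolding fst_ascending_def sorted_wrt_iff_list_order by fastforce
        with jj inv less have "((i, j'), (j', j)) \<in> list_order (inversion_seq w)"
          using list_order_total[of "(i, j')" "inversion_seq w" "(j', j)"] by (auto simp: s)
        from inversion_seq_inner_first[OF w less(2) \<open>j' < j\<close> this] list_order_asym[OF d ab] that
        show False by simp
      qed
    qed
    ultimately show ?thesis by (cases "i = i'") auto
  qed
  then show ?thesis
    unfolding sorted_wrt_iff_list_order by auto
qed

text \<open>Now the inversions between positions after \<open>i\<close> are created later than those
  of \<open>i\<close>, so \<open>i\<close> passes these positions from left to right.\<close>

lemma fst_descending_sorted_wrt:
  assumes w: "ascending_word w" and desc: "fst_descending w"
  shows "sorted_wrt (\<lambda>(i, j) (i', j'). i' < i \<or> i = i' \<and> j' < j) (inversion_seq w)"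
proof -
  note d = inversion_seq_ascending(1)[OF w] and s = inversion_seq_ascending(2)[OF w]
  have "i' < i \<or> i = i' \<and> j' < j"
    if ab: "((i, j), (i', j')) \<in> list_order (inversion_seq w)" for i j i' j'
  proof -
    have "i' \<le> i"
      using desc ab unfolding fst_descending_def sorted_wrt_iff_list_order by auto
    moreover have False if "i = i'" "\<not> j' < j"
    proof -
      have inv: "(i, j) \<in> inv_pairs (word_perm w)" "(i, j') \<in> inv_pairs (word_perm w)"
        and "j \<noteq> j'"
        using list_orderD[OF ab] list_order_asym[OF d ab] that(1) ab by (auto simp: s)
      with that have lt: "j < j'" by simp
      have less: "i < j" using inv by (auto simp: inv_pairs_def)
      show False
      proof (cases "(j, j') \<in> inv_pairs (word_perm w)")
        case False
        with inversion_seq_312[OF w less lt] inv list_order_asym[OF d ab] that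
        show False by simp
      next
        case True
        have "((i, j), (j, j')) \<notin> list_order (inversion_seq w)"
          using desc less unfolding fst_descending_def sorted_wrt_iff_list_order by fastforce
        with True inv less have "((j, j'), (i, j)) \<in> list_order (inversion_seq w)"
          using list_order_total[of "(i, j)" "inversion_seq w" "(j, j')"] by (auto simp: s)
        from inversion_seq_inner_last[OF w less lt this] list_order_asym[OF d ab] that
        show False by simp
      qed
    qed
    ultimately show ?thesis by (cases "i = i'") auto
  qed
  then show ?thesis
    unfolding sorted_wrt_iff_list_order by auto
qed

lemma fst_ascending_unique:
  assumes "ascending_word v" "ascending_word w" "word_perm v = word_perm w"
    and "fst_ascending v" "fst_ascending w"
  shows "v = w"
proof (rule inversion_seq_inject, rule sorted_wrt_unique)
  show "sorted_wrt (\<lambda>(i, j) (i', j'). i < i' \<or> i = i' \<and> word_perm w j' < word_perm w j)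
    (inversion_seq v)"
    using fst_ascending_sorted_wrt[OF assms(1,4)] assms(3) by simp
  show "sorted_wrt (\<lambda>(i, j) (i', j'). i < i' \<or> i = i' \<and> word_perm w j' < word_perm w j)
    (inversion_seq w)"
    by (rule fst_ascending_sorted_wrt[OF assms(2,5)])
qed (use assms inversion_seq_ascending in auto)

lemma fst_descending_unique:
  assumes "ascending_word v" "ascending_word w" "word_perm v = word_perm w"
    and "fst_descending v" "fst_descending w"
  shows "v = w"
proof (rule inversion_seq_inject, rule sorted_wrt_unique)
  show "sorted_wrt (\<lambda>(i, j) (i', j'). i' < i \<or> i = i' \<and> j' < j) (inversion_seq v)"
    by (rule fst_descending_sorted_wrt[OF assms(1,4)])
  show "sorted_wrt (\<lambda>(i, j) (i', j'). i' < i \<or> i = i' \<and> j' < j) (inversion_seq w)"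
    by (rule fst_descending_sorted_wrt[OF assms(2,5)])
qed (use assms inversion_seq_ascending in auto)

section \<open>Moves\<close>

text \<open>This encodes \<open>L\<^sub>2\<close>: the pairs with \<open>snd a \<noteq> fst b\<close> are the disjoint pairs of inversions,
  each listed once, and those with \<open>snd a = fst b\<close> are the 321 patterns.\<close>

definition flippable :: "(nat \<Rightarrow> nat) \<Rightarrow> ((nat \<times> nat) \<times> (nat \<times> nat)) set" where
  "flippable q = {(a, b). a \<in> inv_pairs q \<and> b \<in> inv_pairs q \<and> fst a < fst b \<and> snd a \<noteq> snd b}"

definition height :: "nat list \<Rightarrow> nat" where
  "height w = card (flippable (word_perm w) \<inter> list_order (inversion_seq w))"

lemma finite_flippable: "finite (flippable (word_perm w))"
  by (rule finite_subset[of _ "inv_pairs (word_perm w) \<times> inv_pairs (word_perm w)"])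
    (auto simp: flippable_def finite_inv_pairs_word_perm)

text \<open>Within \<open>Q\<close>, the list orders before and after a move will differ only by
  exchanging a pair \<open>x\<close> for its reverse \<open>y\<close>.\<close>

lemma card_Int_insert_le:
  assumes "finite Q"
  shows "card (Q \<inter> insert x R) \<le> Suc (card (Q \<inter> insert y R))"
proof -
  have "card (Q \<inter> insert x R) \<le> card (insert x (Q \<inter> insert y R))"
    using assms by (intro card_mono) auto
  also have "\<dots> \<le> Suc (card (Q \<inter> insert y R))"
    by (rule card_insert_le_m1) auto
  finally show ?thesis .
qed

lemma card_Int_insert_less:
  assumes "finite Q" "x \<notin> Q" "y \<in> Q" "y \<notin> R"
  shows "card (Q \<inter> insert x R) < card (Q \<inter> insert y R)"
  using assms by (intro psubset_card_mono) auto

lemma list_order_swap: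
  assumes "distinct (us @ [a, b] @ vs)"
  obtains R where "list_order (us @ [a, b] @ vs) = insert (a, b) R"
    "list_order (us @ [b, a] @ vs) = insert (b, a) R" "(a, b) \<notin> R" "(b, a) \<notin> R"
proof
  let ?R = "list_order us \<union> set us \<times> ({a, b} \<union> set vs) \<union> {a, b} \<times> set vs \<union> list_order vs"
  show "list_order (us @ [a, b] @ vs) = insert (a, b) ?R"
    "list_order (us @ [b, a] @ vs) = insert (b, a) ?R"
    by (auto simp: list_order_append)
  show "(a, b) \<notin> ?R" "(b, a) \<notin> ?R"
    using assms by (auto dest: list_orderD)
qed

text \<open>The reversal turns round three pairs; the two that involve the middle entry lie outside
  \<open>Q\<close>.\<close>

lemma list_order_reverse3:
  assumes "distinct (us @ [a, b, c] @ vs)"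
    and "(a, b) \<notin> Q" "(b, a) \<notin> Q" "(b, c) \<notin> Q" "(c, b) \<notin> Q"
  obtains R where "Q \<inter> list_order (us @ [a, b, c] @ vs) = Q \<inter> insert (a, c) R"
    "Q \<inter> list_order (us @ [c, b, a] @ vs) = Q \<inter> insert (c, a) R" "(a, c) \<notin> R" "(c, a) \<notin> R"
proof
  let ?R = "list_order us \<union> set us \<times> ({a, b, c} \<union> set vs) \<union> {a, b, c} \<times> set vs \<union> list_order vs"
  show "Q \<inter> list_order (us @ [a, b, c] @ vs) = Q \<inter> insert (a, c) ?R"
    "Q \<inter> list_order (us @ [c, b, a] @ vs) = Q \<inter> insert (c, a) ?R"
    using assms(2-) by (auto simp: list_order_append)
  show "(a, c) \<notin> ?R" "(c, a) \<notin> ?R"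
    using assms(1) by (auto dest: list_orderD)
qed

lemma inversion_seq_commute:
  fixes v :: "nat list"
  defines "P \<equiv> word_perm (rev v)"
  assumes "\<bar>int r - int s\<bar> > 1"
  obtains us where
    "inversion_seq (u @ [r, s] @ v) = us @ [(P r, P (Suc r)), (P s, P (Suc s))] @ inversion_seq v"
    "inversion_seq (u @ [s, r] @ v) = us @ [(P s, P (Suc s)), (P r, P (Suc r))] @ inversion_seq v"
    "word_perm (u @ [r, s] @ v) = word_perm (u @ [s, r] @ v)"
proof
  have eq: "adj_transp r (adj_transp s x) = adj_transp s (adj_transp r x)" for x
    using assms(2) by (auto simp: transpose_def)
  have fixed: "adj_transp s r = r" "adj_transp s (Suc r) = Suc r"
    "adj_transp r s = s" "adj_transp r (Suc s) = Suc s"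
    using assms(2) by (auto simp: transpose_def)
  \<comment> \<open>Equal products make the prefix \<open>u\<close> contribute the same pairs
    \<open>?us\<close> to both sequences.\<close>
  have perm: "word_perm (rev ([s, r] @ v)) = word_perm (rev ([r, s] @ v))"
    by (simp add: fun_eq_iff word_perm_apply eq)
  let ?us = "map (map_prod (word_perm (rev ([r, s] @ v))) (word_perm (rev ([r, s] @ v)))) (inversion_seq u)"
  show "inversion_seq (u @ [r, s] @ v) =
      ?us @ [(P r, P (Suc r)), (P s, P (Suc s))] @ inversion_seq v"
    by (simp add: inversion_seq_append[of u] word_perm_apply fixed P_def)
  show "inversion_seq (u @ [s, r] @ v) =
      ?us @ [(P s, P (Suc s)), (P r, P (Suc r))] @ inversion_seq v"
    unfolding perm[symmetric]
    by (simp add: inversion_seq_append[of u] word_perm_apply fixed P_def)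
  show "word_perm (u @ [r, s] @ v) = word_perm (u @ [s, r] @ v)"
    by (simp add: fun_eq_iff word_perm_apply eq)
qed

text \<open>Both middle parts reverse the values \<open>r\<close>, \<open>Suc r\<close>,
  \<open>Suc (Suc r)\<close> and run through the same three pairs in opposite orders.\<close>

lemma inversion_seq_braid:
  fixes v :: "nat list" and r :: nat
  defines "P \<equiv> word_perm (rev v)"
  defines "i \<equiv> P r" and "j \<equiv> P (Suc r)" and "k \<equiv> P (Suc (Suc r))"
  obtains us where
    "inversion_seq (u @ [r, Suc r, r] @ v) = us @ [(j, k), (i, k), (i, j)] @ inversion_seq v"
    "inversion_seq (u @ [Suc r, r, Suc r] @ v) = us @ [(i, j), (i, k), (j, k)] @ inversion_seq v"
    "word_perm (u @ [r, Suc r, r] @ v) = word_perm (u @ [Suc r, r, Suc r] @ v)"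
proof
  have eq: "adj_transp r (adj_transp (Suc r) (adj_transp r x)) =
    adj_transp (Suc r) (adj_transp r (adj_transp (Suc r) x))" for x
    by (auto simp: transpose_def)
  have vals: "adj_transp r (Suc (Suc r)) = Suc (Suc r)" "adj_transp (Suc r) r = r"
    by (auto simp: transpose_def)
  let ?w = "[Suc r, r, Suc r] @ v"
  have perm: "word_perm (rev ([r, Suc r, r] @ v)) = word_perm (rev ?w)"
    by (simp add: fun_eq_iff word_perm_apply eq)
  let ?us = "map (map_prod (word_perm (rev ?w)) (word_perm (rev ?w))) (inversion_seq u)"
  show "inversion_seq (u @ [r, Suc r, r] @ v) = ?us @ [(j, k), (i, k), (i, j)] @ inversion_seq v"
    unfolding perm[symmetric]
    by (simp add: inversion_seq_append[of u] word_perm_apply vals P_def i_def j_def k_def)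
  show "inversion_seq (u @ ?w) = ?us @ [(i, j), (i, k), (j, k)] @ inversion_seq v"
    by (simp add: inversion_seq_append[of u] word_perm_apply vals P_def i_def j_def k_def)
  show "word_perm (u @ [r, Suc r, r] @ v) = word_perm (u @ ?w)"
    by (simp add: fun_eq_iff word_perm_apply eq)
qed

section \<open>Effect of a move on the height\<close>

lemma height_commute_le:
  assumes "ascending_word (u @ [r, s] @ v)" "\<bar>int r - int s\<bar> > 1"
  shows "height (u @ [r, s] @ v) \<le> Suc (height (u @ [s, r] @ v))"
proof -
  let ?P = "word_perm (rev v)"
  let ?a = "(?P r, ?P (Suc r))" and ?b = "(?P s, ?P (Suc s))"
  obtain us where us:
    "inversion_seq (u @ [r, s] @ v) = us @ [?a, ?b] @ inversion_seq v"
    "inversion_seq (u @ [s, r] @ v) = us @ [?b, ?a] @ inversion_seq v"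
    "word_perm (u @ [r, s] @ v) = word_perm (u @ [s, r] @ v)"
    using inversion_seq_commute[OF assms(2)] by metis
  have "distinct (us @ [?a, ?b] @ inversion_seq v)"
    using inversion_seq_ascending(1)[OF assms(1)] us(1) by simp
  then show ?thesis
    unfolding height_def us
    by (rule list_order_swap) (simp only: card_Int_insert_le finite_flippable)
qed

lemma height_commute_less:
  fixes v :: "nat list"
  defines "P \<equiv> word_perm (rev v)"
  assumes w: "ascending_word (u @ [r, s] @ v)" and rs: "\<bar>int r - int s\<bar> > 1"
  shows "P s < P r \<Longrightarrow> height (u @ [r, s] @ v) < height (u @ [s, r] @ v)"
    and "P r < P s \<Longrightarrow> height (u @ [s, r] @ v) < height (u @ [r, s] @ v)"
proof -
  let ?a = "(P r, P (Suc r))" and ?b = "(P s, P (Suc s))"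
  obtain us where us:
    "inversion_seq (u @ [r, s] @ v) = us @ [?a, ?b] @ inversion_seq v"
    "inversion_seq (u @ [s, r] @ v) = us @ [?b, ?a] @ inversion_seq v"
    "word_perm (u @ [r, s] @ v) = word_perm (u @ [s, r] @ v)"
    unfolding P_def using inversion_seq_commute[OF rs] by metis
  have "distinct (us @ [?a, ?b] @ inversion_seq v)"
    using inversion_seq_ascending(1)[OF w] us(1) by simp
  then obtain R where R: "list_order (us @ [?a, ?b] @ inversion_seq v) = insert (?a, ?b) R"
    "list_order (us @ [?b, ?a] @ inversion_seq v) = insert (?b, ?a) R" "(?a, ?b) \<notin> R" "(?b, ?a) \<notin> R"
    by (rule list_order_swap)
  have mem: "?a \<in> inv_pairs (word_perm (u @ [s, r] @ v))" "?b \<in> inv_pairs (word_perm (u @ [s, r] @ v))"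
    using inversion_seq_ascending(2)[OF w] us(1,3) by auto
  have ne: "P (Suc r) \<noteq> P (Suc s)"
    using rs by (auto simp: P_def)
  show "P s < P r \<Longrightarrow> height (u @ [r, s] @ v) < height (u @ [s, r] @ v)"
    unfolding height_def us R using R mem ne
    by (intro card_Int_insert_less finite_flippable) (auto simp: flippable_def)
  show "P r < P s \<Longrightarrow> height (u @ [s, r] @ v) < height (u @ [r, s] @ v)"
    unfolding height_def us R using R mem ne
    by (intro card_Int_insert_less finite_flippable) (auto simp: flippable_def)
qed

text \<open>The middle inversion \<open>(i, k)\<close> shares its first entry with
  \<open>(i, j)\<close> and its second with \<open>(j, k)\<close>, so \<open>flippable\<close> sees
  only the outer pair. Here \<open>p\<close> is \<open>((i, j), (j, k))\<close> and \<open>q\<close>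
  its reverse.\<close>

lemma braid_flip:
  fixes u v :: "nat list" and r :: nat
  defines "x \<equiv> u @ [r, Suc r, r] @ v" and "y \<equiv> u @ [Suc r, r, Suc r] @ v"
  assumes asc: "ascending_word x \<or> ascending_word y"
  obtains R p q where "p \<in> flippable (word_perm x)" "q \<notin> flippable (word_perm x)" "p \<notin> R"
    "flippable (word_perm x) \<inter> list_order (inversion_seq x) = flippable (word_perm x) \<inter> insert q R"
    "flippable (word_perm x) \<inter> list_order (inversion_seq y) = flippable (word_perm x) \<inter> insert p R"
    "word_perm y = word_perm x"
proof -
  let ?P = "word_perm (rev v)"
  define i j k where ijk: "i = ?P r" "j = ?P (Suc r)" "k = ?P (Suc (Suc r))"
  obtain us where us:
    "inversion_seq x = us @ [(j, k), (i, k), (i, j)] @ inversion_seq v"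
    "inversion_seq y = us @ [(i, j), (i, k), (j, k)] @ inversion_seq v"
    "word_perm x = word_perm y"
    unfolding x_def y_def ijk by (rule inversion_seq_braid)
  have sets: "set (inversion_seq x) = set (inversion_seq y)"
    "distinct (inversion_seq x) \<longleftrightarrow> distinct (inversion_seq y)"
    by (auto simp: us)
  then have "ascending_word x" "ascending_word y"
    using asc by (auto simp: ascending_word_def)
  then have d: "distinct (inversion_seq x)" and s: "set (inversion_seq x) = inv_pairs (word_perm x)"
    by (auto simp: inversion_seq_ascending)
  have lt: "i < j" "j < k"
  proof -
    have "(i, j) \<in> inv_pairs (word_perm x)" "(j, k) \<in> inv_pairs (word_perm x)"
      using s us(1) by auto
    then show "i < j" "j < k" by (auto simp: inv_pairs_def)
  qed
  have "((i, j), (j, k)) \<in> flippable (word_perm x)"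
    using lt s us(1) by (auto simp: flippable_def)
  moreover have no: "((j, k), (i, k)) \<notin> flippable (word_perm x)" "((i, k), (j, k)) \<notin> flippable (word_perm x)"
    "((i, k), (i, j)) \<notin> flippable (word_perm x)" "((i, j), (i, k)) \<notin> flippable (word_perm x)"
    "((j, k), (i, j)) \<notin> flippable (word_perm x)"
    using lt by (auto simp: flippable_def)
  moreover obtain R where
    "flippable (word_perm x) \<inter> list_order (inversion_seq x) = flippable (word_perm x) \<inter> insert ((j, k), (i, j)) R"
    "flippable (word_perm x) \<inter> list_order (inversion_seq y) = flippable (word_perm x) \<inter> insert ((i, j), (j, k)) R"
    "((i, j), (j, k)) \<notin> R"
    using list_order_reverse3[OF d[unfolded us(1)] no(1-4)] unfolding us by metis
  ultimately show ?thesis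
    using that us(3) by metis
qed

lemma height_braid_le:
  assumes "ascending_word (u @ [r, Suc r, r] @ v) \<or> ascending_word (u @ [Suc r, r, Suc r] @ v)"
  shows "height (u @ [r, Suc r, r] @ v) \<le> Suc (height (u @ [Suc r, r, Suc r] @ v))"
    and "height (u @ [Suc r, r, Suc r] @ v) \<le> Suc (height (u @ [r, Suc r, r] @ v))"
  by (rule braid_flip[OF assms], simp only: height_def card_Int_insert_le finite_flippable)+

lemma height_braid_less:
  assumes "ascending_word (u @ [r, Suc r, r] @ v) \<or> ascending_word (u @ [Suc r, r, Suc r] @ v)"
  shows "height (u @ [r, Suc r, r] @ v) < height (u @ [Suc r, r, Suc r] @ v)"
  by (rule braid_flip[OF assms], simp only: height_def card_Int_insert_less finite_flippable not_False_eq_True)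

lemma height_move_le:
  assumes "ascending_word u" "commutation_move u v \<or> braid_move u v"
  shows "height u \<le> Suc (height v)"
  using assms(2)
proof
  assume "commutation_move u v"
  then show ?thesis
    using assms(1) height_commute_le unfolding commutation_move_def by blast
next
  assume "braid_move u v"
  then show ?thesis
    using assms(1) height_braid_le unfolding braid_move_def by blast
qed

lemma words_for_move:
  assumes "commutation_move u v \<or> braid_move u v" "u \<in> words_for n p"
  shows "v \<in> words_for n p"
  using assms(1)
proof
  assume "commutation_move u v"
  then obtain xs ys j k where "\<bar>int j - int k\<bar> > 1" "u = xs @ [j, k] @ ys" "v = xs @ [k, j] @ ys"
    by (auto simp: commutation_move_def)
  with assms(2) inversion_seq_commute[of j k xs ys] show ?thesis
    unfolding words_for_def by (metis (lifting) Un_insert_left Un_insert_right insert_commute list.simps(15) mem_Collect_eq set_append)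
next
  assume "braid_move u v"
  then obtain xs ys j where
    *: "(u = xs @ [j, Suc j, j] @ ys \<and> v = xs @ [Suc j, j, Suc j] @ ys) \<or>
     (u = xs @ [Suc j, j, Suc j] @ ys \<and> v = xs @ [j, Suc j, j] @ ys)"
    by (auto simp: braid_move_def)
  have "word_perm (xs @ [j, Suc j, j] @ ys) = word_perm (xs @ [Suc j, j, Suc j] @ ys)"
    using inversion_seq_braid[of xs j ys] by blast
  moreover have "set v = set u" using * by auto
  ultimately show ?thesis
    using * assms(2) unfolding words_for_def by auto
qed

lemma reduced_words_move:
  assumes "commutation_move u v \<or> braid_move u v" "u \<in> reduced_words n p"
  shows "v \<in> reduced_words n p"
proof -
  have "length v = length u"
    using assms(1) unfolding commutation_move_def braid_move_def by auto
  with assms words_for_move[OF assms(1)] show ?thesis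
    by (auto simp: reduced_words_def)
qed

text \<open>Takes the rightmost descent, in an inversion sequence the earliest in time.\<close>

lemma not_sorted_wrt_suffixE:
  fixes f :: "'a \<Rightarrow> 'b :: linorder"
  assumes "\<not> sorted_wrt (\<lambda>a b. f a \<le> f b) xs"
  obtains us a b vs where "xs = us @ a # b # vs" "f b < f a"
    "sorted_wrt (\<lambda>a b. f a \<le> f b) (b # vs)"
proof -
  have "\<exists>us a b vs. xs = us @ a # b # vs \<and> f b < f a \<and> sorted_wrt (\<lambda>a b. f a \<le> f b) (b # vs)"
    using assms
  proof (induction xs)
    case (Cons x xs)
    show ?case
    proof (cases "sorted_wrt (\<lambda>a b. f a \<le> f b) xs")
      case True
      then obtain b vs where xs: "xs = b # vs"
        using Cons.prems by (cases xs) auto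
      have "f b < f x"
        using Cons.prems True unfolding xs by (auto simp: not_le)
      with True xs show ?thesis
        by (intro exI[of _ "[]"] exI[of _ x] exI[of _ b] exI[of _ vs]) simp
    next
      case False
      then show ?thesis
        using Cons.IH by (metis append_Cons)
    qed
  qed simp
  with that show ?thesis by blast
qed

text \<open>The mirror image: the leftmost ascent, hence the latest in time.\<close>

lemma not_sorted_wrt_prefixE:
  fixes f :: "'a \<Rightarrow> 'b :: linorder"
  assumes "\<not> sorted_wrt (\<lambda>a b. f b \<le> f a) xs"
  obtains us a b vs where "xs = us @ a # b # vs" "f a < f b"
    "sorted_wrt (\<lambda>a b. f b \<le> f a) (us @ [a])"
proof -
  have "\<not> sorted_wrt (\<lambda>a b. f a \<le> f b) (rev xs)"
    using assms by (simp add: sorted_wrt_rev)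
  then obtain us a b vs where *: "rev xs = us @ a # b # vs" "f b < f a"
    "sorted_wrt (\<lambda>a b. f a \<le> f b) (b # vs)"
    by (rule not_sorted_wrt_suffixE)
  have "xs = rev (us @ a # b # vs)"
    using *(1) by (metis rev_rev_ident)
  moreover have "sorted_wrt (\<lambda>a b. f b \<le> f a) (rev (b # vs))"
    using *(3) by (simp only: sorted_wrt_rev)
  ultimately show ?thesis
    using that[of "rev vs" b a "rev us"] *(2) by simp
qed

section \<open>Climbing towards the sorted words\<close>

text \<open>At the rightmost descent the two letters either commute or are \<open>r\<close>,
  \<open>Suc r\<close>. In the second case the two first entries already form an inversion, and the
  sorted tail forces the next letter to be \<open>r\<close>, which completes a braid.\<close>

lemma ex_move_up:
  assumes w: "ascending_word w" and "\<not> fst_ascending w"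
  shows "\<exists>v. (commutation_move w v \<or> braid_move w v) \<and> height w < height v"
proof -
  obtain us a b vs where L: "inversion_seq w = us @ a # b # vs" and less: "fst b < fst a"
    and sorted: "sorted_wrt (\<lambda>a b. fst a \<le> fst b) (b # vs)"
    using assms(2) unfolding fst_ascending_def by (rule not_sorted_wrt_suffixE)
  obtain u v' where w_eq: "w = u @ v'" and v': "inversion_seq v' = a # b # vs"
    using inversion_seq_eq_append[OF L] by metis
  obtain r s v where v'_eq: "v' = r # s # v"
    using v' by (metis inversion_seq.simps(1) inversion_seq.elims list.distinct(1) list.inject)
  let ?P = "word_perm (rev v)"
  have asc_v': "ascending_word v'"
    using w w_eq ascending_word_append by blast
  have a: "a = (?P (adj_transp s r), ?P (adj_transp s (Suc r)))" and b: "b = (?P s, ?P (Suc s))"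
    and vs: "vs = inversion_seq v"
    using v' by (simp_all add: v'_eq word_perm_apply)
  have lt: "fst a < snd a" "fst b < snd b"
    using asc_v' v' by (auto simp: ascending_word_def)
  \<comment> \<open>Equal letters would undo an inversion, and \<open>r = Suc s\<close> would give
    \<open>a\<close> and \<open>b\<close> the same first entry.\<close>
  have "r \<noteq> s" "r \<noteq> Suc s"
    using lt less by (auto simp: a b)
  then consider "\<bar>int r - int s\<bar> > 1" | "s = Suc r" by linarith
  then show ?thesis
  proof cases
    case 1
    then have "?P s < ?P r"
      using less by (simp add: a b transpose_def split: if_splits)
    then have "height w < height (u @ [s, r] @ v)"
      using height_commute_less(1)[of u r s v] w 1 by (simp add: w_eq v'_eq)
    moreover have "commutation_move w (u @ [s, r] @ v)"
      using 1 unfolding commutation_move_def w_eq v'_eq by (metis append_Cons append_Nil)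
    ultimately show ?thesis by blast
  next
    case 2
    define i j where "i = ?P (Suc r)" and "j = ?P r"
    have a_eq: "fst a = j" and b_eq: "fst b = i"
      by (simp_all add: a b 2 i_def j_def transpose_def)
    have "(i, j) \<in> inv_pairs (word_perm v)"
      using less a_eq b_eq by (simp add: inv_pairs_def i_def j_def)
    moreover have "ascending_word v"
      using asc_v' ascending_word_append[of "[r, s]" v] by (simp add: v'_eq)
    ultimately have mem: "(i, j) \<in> set vs"
      using inversion_seq_ascending(2) vs by blast
    then obtain c vs' where vs_eq: "vs = c # vs'" by (cases vs) auto
    \<comment> \<open>The tail starts with \<open>c\<close> and contains \<open>(i, j)\<close>, so
      its sorting squeezes \<open>fst c\<close> between \<open>fst b = i\<close> and
      \<open>i\<close>.\<close>
    have "fst b \<le> fst c" "fst c \<le> i"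
      using sorted mem by (auto simp: vs_eq)
    with b_eq have c: "fst c = i" by simp
    obtain t v'' where v_eq: "v = t # v''"
      using vs vs_eq by (cases v) auto
    \<comment> \<open>The letter \<open>t\<close> lifts position \<open>i\<close> from value
      \<open>t\<close> to \<open>Suc t\<close>, and afterwards \<open>i\<close> holds
      \<open>Suc r\<close>.\<close>
    have "word_perm (rev v'') (adj_transp t (Suc r)) = word_perm (rev v'') t"
      using c vs vs_eq by (simp add: v_eq i_def word_perm_apply)
    then have "t = r"
      by (simp add: transpose_def split: if_splits)
    then have w_eq': "w = u @ [r, Suc r, r] @ v''"
      by (simp add: w_eq v'_eq v_eq 2)
    then have "height w < height (u @ [Suc r, r, Suc r] @ v'')"
      using height_braid_less w by blast
    moreover have "braid_move w (u @ [Suc r, r, Suc r] @ v'')"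
      unfolding braid_move_def w_eq' by blast
    ultimately show ?thesis by blast
  qed
qed

text \<open>By the 231-avoidance hypothesis, once \<open>j\<close> and \<open>i\<close> have passed \<open>k\<close>, \<open>i\<close> still has to pass
  \<open>j\<close>, which completes a braid.\<close>

lemma ex_move_down:
  assumes w: "ascending_word w" and "\<not> fst_descending w"
    and avoid: "\<And>i j k. i < j \<Longrightarrow> (i, k) \<in> inv_pairs (word_perm w) \<Longrightarrow>
      (j, k) \<in> inv_pairs (word_perm w) \<Longrightarrow> (i, j) \<in> inv_pairs (word_perm w)"
  shows "\<exists>v. (commutation_move w v \<or> braid_move w v) \<and> height v < height w"
proof -
  obtain us a b vs where L: "inversion_seq w = us @ a # b # vs" and less: "fst a < fst b"
    and sorted: "sorted_wrt (\<lambda>a b. fst b \<le> fst a) (us @ [a])"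
    using assms(2) unfolding fst_descending_def by (rule not_sorted_wrt_prefixE)
  obtain u v' where w_eq: "w = u @ v'" and v': "inversion_seq v' = a # b # vs"
    and u: "map (map_prod (word_perm (rev v')) (word_perm (rev v'))) (inversion_seq u) = us"
    using inversion_seq_eq_append[OF L] by metis
  obtain r s v where v'_eq: "v' = r # s # v"
    using v' by (metis inversion_seq.simps(1) inversion_seq.elims list.distinct(1) list.inject)
  let ?P = "word_perm (rev v)"
  have asc_v': "ascending_word v'"
    using w w_eq ascending_word_append by blast
  have a: "a = (?P (adj_transp s r), ?P (adj_transp s (Suc r)))" and b: "b = (?P s, ?P (Suc s))"
    using v' by (simp_all add: v'_eq word_perm_apply)
  have lt: "fst a < snd a" "fst b < snd b"
    using asc_v' v' by (auto simp: ascending_word_def)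
  have "r \<noteq> s" "r \<noteq> Suc s"
    using lt less by (auto simp: a b)
  then consider "\<bar>int r - int s\<bar> > 1" | "s = Suc r" by linarith
  then show ?thesis
  proof cases
    case 1
    then have "?P r < ?P s"
      using less by (simp add: a b transpose_def split: if_splits)
    then have "height (u @ [s, r] @ v) < height w"
      using height_commute_less(2)[of u r s v] w 1 by (simp add: w_eq v'_eq)
    moreover have "commutation_move w (u @ [s, r] @ v)"
      using 1 unfolding commutation_move_def w_eq v'_eq by (metis append_Cons append_Nil)
    ultimately show ?thesis by blast
  next
    case 2
    define i j k where ijk: "i = ?P r" "j = ?P (Suc r)" "k = ?P (Suc (Suc r))"
    have ab: "a = (i, k)" "b = (j, k)"
      by (simp_all add: a b 2 ijk transpose_def)
    have inv: "inv_pairs (word_perm w) = set us \<union> set (inversion_seq v')"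
      using inversion_seq_ascending(2)[OF w] L v' by auto
    have "(i, j) \<in> inv_pairs (word_perm w)"
      using avoid[of i j k] less v' by (simp add: inv ab)
    \<comment> \<open>After \<open>v'\<close> the positions \<open>k\<close>, \<open>i\<close>,
      \<open>j\<close> hold the values \<open>r\<close>, \<open>Suc r\<close>,
      \<open>Suc (Suc r)\<close>, so \<open>i\<close> has not passed \<open>j\<close> yet.\<close>
    moreover have "(i, j) \<notin> inv_pairs (word_perm v')"
      by (simp add: inv_pairs_def ijk v'_eq 2 word_perm_apply transpose_def)
    ultimately have mem: "(i, j) \<in> set us"
      using inversion_seq_ascending(2)[OF asc_v'] inv by blast
    then obtain us' c where us_eq: "us = us' @ [c]"
      by (cases us rule: rev_cases) auto
    \<comment> \<open>Now \<open>c\<close> is the inversion created right after \<open>a\<close>;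
      the sorted prefix, which contains \<open>(i, j)\<close>, squeezes its first entry.\<close>
    have "fst a \<le> fst c" "fst c \<le> i"
      using sorted mem by (auto simp: us_eq sorted_wrt_append)
    with ab have c: "fst c = i" by simp
    obtain u' t where u_eq: "u = u' @ [t]"
      using u us_eq by (cases u rule: rev_cases) auto
    have "c = (word_perm (rev v') t, word_perm (rev v') (Suc t))"
      using u us_eq by (simp add: u_eq inversion_seq_append)
    \<comment> \<open>Position \<open>i\<close> holds \<open>r\<close> after \<open>v\<close>, and
      \<open>t\<close> is its value after \<open>v'\<close>.\<close>
    then have "adj_transp s (adj_transp r t) = r"
      using c by (simp add: v'_eq word_perm_apply ijk)
    then have "t = Suc r"
      by (simp add: 2 transpose_def split: if_splits)
    then have w_eq': "w = u' @ [Suc r, r, Suc r] @ v"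
      by (simp add: w_eq v'_eq u_eq 2)
    then have "height (u' @ [r, Suc r, r] @ v) < height w"
      using height_braid_less w by blast
    moreover have "braid_move w (u' @ [r, Suc r, r] @ v)"
      unfolding braid_move_def w_eq' by blast
    ultimately show ?thesis by blast
  qed
qed

section \<open>Extreme heights and the size of \<open>L2\<close>\<close>

lemma height_fst_ascending:
  assumes w: "ascending_word w" and "fst_ascending w"
  shows "height w = card (flippable (word_perm w))"
proof -
  have "(a, b) \<in> list_order (inversion_seq w)" if ab: "(a, b) \<in> flippable (word_perm w)" for a b
  proof -
    have "(b, a) \<notin> list_order (inversion_seq w)"
      using assms(2) ab unfolding fst_ascending_def sorted_wrt_iff_list_order flippable_def by force
    with ab list_order_total[of a "inversion_seq w" b] inversion_seq_ascending(2)[OF w]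
    show ?thesis by (auto simp: flippable_def)
  qed
  then have "flippable (word_perm w) \<inter> list_order (inversion_seq w) = flippable (word_perm w)"
    by auto
  then show ?thesis
    by (simp add: height_def)
qed

lemma height_fst_descending:
  assumes "fst_descending w"
  shows "height w = 0"
proof -
  have "flippable (word_perm w) \<inter> list_order (inversion_seq w) = {}"
    using assms unfolding fst_descending_def sorted_wrt_iff_list_order flippable_def by force
  then show ?thesis
    by (simp add: height_def)
qed

lemma height_le: "height w \<le> card (flippable (word_perm w))"
  unfolding height_def by (intro card_mono finite_flippable) auto

text \<open>For \<open>snd a \<noteq> fst b\<close> the inversions are disjoint, since
  \<open>fst a < fst b < snd b\<close> rules out the remaining coincidence, and the order of first
  entries selects one representative of each unordered pair. For \<open>snd a = fst b\<close> the
  outer inversions determine the 321 pattern.\<close>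

lemma card_flippable:
  assumes "p permutes {1..n}"
  shows "card (flippable p) = card_L2 n p"
proof -
  let ?I = "inversions n p"
  let ?D = "{(a, b) \<in> flippable p. snd a \<noteq> fst b}" and ?T = "{(a, b) \<in> flippable p. snd a = fst b}"
  have fl: "flippable p = {(a, b). a \<in> ?I \<and> b \<in> ?I \<and> fst a < fst b \<and> snd a \<noteq> snd b}"
    by (simp add: flippable_def inv_pairs_permutes[OF assms])
  have fin: "finite (flippable p)"
    by (rule finite_subset[of _ "?I \<times> ?I"]) (auto simp: fl finite_inversions)
  have I: "fst a < snd a" if "a \<in> ?I" for a
    using that by (auto simp: inversions_def)
  have "bij_betw (\<lambda>(a, b). {a, b}) ?D (I2 n p)"
  proof (intro bij_betwI')
    fix x y assume "x \<in> ?D" "y \<in> ?D"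
    then show "(case x of (a, b) \<Rightarrow> {a, b}) = (case y of (a, b) \<Rightarrow> {a, b}) \<longleftrightarrow> x = y"
      by (auto simp: fl doubleton_eq_iff)
  next
    fix x assume x: "x \<in> ?D"
    then obtain i j k l where "x = ((i, j), (k, l))" by (metis surj_pair)
    with x show "(case x of (a, b) \<Rightarrow> {a, b}) \<in> I2 n p"
      unfolding I2_def mem_Collect_eq fl using I[of "(k, l)"]
      by (intro exI[of _ i] exI[of _ j] exI[of _ k] exI[of _ l]) auto
  next
    fix y assume "y \<in> I2 n p"
    then obtain i j k l where y: "y = {(i, j), (k, l)}" "(i, j) \<in> ?I" "(k, l) \<in> ?I" "{i, j} \<inter> {k, l} = {}"
      unfolding I2_def by blast
    show "\<exists>x \<in> ?D. y = (case x of (a, b) \<Rightarrow> {a, b})"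
    proof (cases "i < k")
      case True
      with y show ?thesis by (intro bexI[of _ "((i, j), (k, l))"]) (auto simp: fl)
    next
      case False
      with y show ?thesis by (intro bexI[of _ "((k, l), (i, j))"]) (auto simp: fl)
    qed
  qed
  then have D: "card ?D = card (I2 n p)"
    by (rule bij_betw_same_card)
  have "bij_betw (\<lambda>(a, b). (a, (fst a, snd b), b)) ?T (I3 n p)"
  proof (intro bij_betwI')
    fix x y assume "x \<in> ?T" "y \<in> ?T"
    then show "(case x of (a, b) \<Rightarrow> (a, (fst a, snd b), b)) = (case y of (a, b) \<Rightarrow> (a, (fst a, snd b), b))
        \<longleftrightarrow> x = y"
      by (auto simp: fl)
  next
    fix x assume "x \<in> ?T"
    then show "(case x of (a, b) \<Rightarrow> (a, (fst a, snd b), b)) \<in> I3 n p"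
      unfolding I3_def by (auto simp: fl inversions_def)
  next
    fix y assume "y \<in> I3 n p"
    then obtain i j k where "y = ((i, j), (i, k), (j, k))" "i < j" "j < k"
      "(i, j) \<in> ?I" "(j, k) \<in> ?I"
      unfolding I3_def by blast
    then show "\<exists>x \<in> ?T. y = (case x of (a, b) \<Rightarrow> (a, (fst a, snd b), b))"
      by (intro bexI[of _ "((i, j), (j, k))"]) (auto simp: fl)
  qed
  then have T: "card ?T = card (I3 n p)"
    by (rule bij_betw_same_card)
  have "flippable p = ?D \<union> ?T" "?D \<inter> ?T = {}"
    by auto
  then have "card (flippable p) = card ?D + card ?T"
    using fin by (metis (lifting) card_Un_disjoint finite_Un)
  with D T show ?thesis
    by (simp add: card_L2_def)
qed

text \<open>Otherwise \<open>p k < p i < p j\<close> with \<open>i < j < k\<close>, an occurrence of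
  231.\<close>

lemma avoids_231_inv_pairs:
  assumes p: "p permutes {1..n}" and avoids: "avoids n p [2, 3, 1]"
    and "i < j" and ik: "(i, k) \<in> inv_pairs p" and jk: "(j, k) \<in> inv_pairs p"
  shows "(i, j) \<in> inv_pairs p"
proof (rule ccontr)
  assume "(i, j) \<notin> inv_pairs p"
  with \<open>i < j\<close> have "p i \<le> p j" by (simp add: inv_pairs_def not_less)
  moreover have "p i \<noteq> p j"
    using \<open>i < j\<close> permutes_inj[OF p] by (auto dest: injD)
  ultimately have less: "p i < p j" by simp
  have jk': "j < k" "p k < p j" "p k < p i"
    using ik jk by (auto simp: inv_pairs_def)
  have mem: "i \<in> {1..n}" "j \<in> {1..n}" "k \<in> {1..n}"
    using ik jk by (auto simp: inv_pairs_permutes[OF p] inversions_def)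
  \<comment> \<open>Filtering the positions exhibits \<open>[i, j, k]\<close> as a subsequence: both
    lists are sorted, distinct and have the same set.\<close>
  have "filter (\<lambda>x. x \<in> {i, j, k}) [1..<Suc n] = [i, j, k]"
  proof (rule sorted_distinct_set_unique)
    show "set (filter (\<lambda>x. x \<in> {i, j, k}) [1..<Suc n]) = set [i, j, k]"
      using mem by auto
    show "sorted (filter (\<lambda>x. x \<in> {i, j, k}) [1..<Suc n])"
      by (intro sorted_wrt_filter sorted_upt)
  qed (use \<open>i < j\<close> jk' in auto)
  then have "subseq [i, j, k] [1..<Suc n]"
    by (metis subseq_filter_left)
  then have "subseq (map p [i, j, k]) (one_line n p)"
    unfolding one_line_def by (rule subseq_map)
  moreover have "order_isomorphic (map p [i, j, k]) [2, 3, 1]"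
    using less jk' by (auto simp: order_isomorphic_def less_Suc_eq numeral_3_eq_3 numeral_2_eq_2)
  ultimately show False
    using avoids unfolding avoids_def by blast
qed

theorem theorem6p7:
  fixes n :: nat and \<pi> :: "nat \<Rightarrow> nat"
  assumes "\<pi> permutes {1..n}"
    and "avoids n \<pi> [2, 3, 1]"
  shows "diameter (with_proj (reduced_word_graph n \<pi>)) = ereal (real (card_L2 n \<pi>))"
proof (rule diameter_eqI[where f = height and A = fst_ascending and B = fst_descending])
  let ?G = "reduced_word_graph n \<pi>"
  have verts: "w \<in> pverts ?G \<longleftrightarrow> w \<in> reduced_words n \<pi>" for w
    by (simp add: reduced_word_graph_def)
  \<comment> \<open>A move keeps length and product, so its target is reduced as soon as its source
    is.\<close>
  have arcs: "(u, v) \<in> parcs ?G \<longleftrightarrow>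
    u \<in> reduced_words n \<pi> \<and> (commutation_move u v \<or> braid_move u v)" for u v
    using reduced_words_move by (auto simp: reduced_word_graph_def)
  have reduced: "ascending_word w" "word_perm w = \<pi>" if "w \<in> reduced_words n \<pi>" for w
    using that by (auto simp: reduced_words_eq[OF assms(1)] words_for_def)
  show "pair_graph ?G"
    by (rule pair_graph_reduced_word_graph)
  show "pverts ?G \<noteq> {}"
    using reduced_words_nonempty[OF assms(1)] verts by blast
  show "height u \<le> Suc (height v)" if "(u, v) \<in> parcs ?G" for u v
    using that height_move_le reduced(1) unfolding arcs by blast
  show "\<exists>v. (u, v) \<in> parcs ?G \<and> height u < height v" if "u \<in> pverts ?G" "\<not> fst_ascending u" for u
    using that ex_move_up reduced(1) unfolding arcs verts by blast
  show "\<exists>v. (u, v) \<in> parcs ?G \<and> height v < height u" if "u \<in> pverts ?G" "\<not> fst_descending u" for u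
    using that ex_move_down[of u] reduced[of u] avoids_231_inv_pairs[OF assms] unfolding arcs verts by metis
  show "height u \<le> card_L2 n \<pi>" if "u \<in> pverts ?G" for u
    using that height_le[of u] reduced(2) unfolding verts by (simp add: card_flippable[OF assms(1)])
  show "height u = card_L2 n \<pi>" if "u \<in> pverts ?G" "fst_ascending u" for u
    using that height_fst_ascending[of u] reduced[of u] unfolding verts
    by (simp add: card_flippable[OF assms(1)])
  show "height u = 0" if "u \<in> pverts ?G" "fst_descending u" for u
    using that height_fst_descending by blast
  show "u = v" if "u \<in> pverts ?G" "v \<in> pverts ?G" "fst_ascending u" "fst_ascending v" for u v
    using that fst_ascending_unique reduced unfolding verts by simp
  show "u = v" if "u \<in> pverts ?G" "v \<in> pverts ?G" "fst_descending u" "fst_descending v" for u v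
    using that fst_descending_unique reduced unfolding verts by simp
qed

end
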